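(* Let $k\ge 1$ be an integer. If $\mathcal A$ is a splitting family on $k$, then $|\mathcal A|\ge k/2$. As a consequence, the minimum size of a splitting family on $k$ is exactly $\lceil k/2\rceil$.
   Context: Let $[k]=\{1,\dots,k\}$. For $A,B\subseteq[k]$, $A$ splits $B$ if $|A\cap B|=|B|/2$ when $|B|$ is even, and $|A\cap B|\in\{(|B|-1)/2,(|B|+1)/2\}$ when $|B|$ is odd. A collection $\mathcal A$ of subsets of $[k]$ is a splitting family on $k$ if for every $B\subseteq[k]$ there is $A\in\mathcal A$ such that $A$ splits $B$. *)

theory Defs
  imports Complex_Main
begin

text \<open>The divisions on \<^typ>\<open>nat\<close> below are exact because of the parity case distinction, and the
  subtraction does not truncate since an odd cardinality is positive.\<close>

definition splits :: "nat set \<Rightarrow> nat set \<Rightarrow> bool" where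
  "splits A B \<longleftrightarrow>
     (if even (card B) then card (A \<inter> B) = card B div 2
      else card (A \<inter> B) \<in> {(card B - 1) div 2, (card B + 1) div 2})"

definition splitting_family :: "nat \<Rightarrow> nat set set \<Rightarrow> bool" where
  "splitting_family k \<A> \<longleftrightarrow>
     \<A> \<subseteq> Pow {1..k} \<and> (\<forall>B. B \<subseteq> {1..k} \<longrightarrow> (\<exists>A\<in>\<A>. splits A B))"

definition splitting_family_sizes :: "nat \<Rightarrow> nat set" where
  "splitting_family_sizes k = {card \<A> |\<A>. splitting_family k \<A>}"

text \<open>The set of sizes is finite and nonempty, so its \<^const>\<open>Min\<close> is a genuine minimum.\<close>

lemma splitting_family_finite: "splitting_family k \<A> \<Longrightarrow> finite \<A>"
  unfolding splitting_family_def by (meson finite_Pow_iff finite_atLeastAtMost finite_subset)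

lemma splitting_family_Pow: "splitting_family k (Pow {1..k})"
  unfolding splitting_family_def
proof (intro conjI allI impI)
  fix B :: "nat set" assume B: "B \<subseteq> {1..k}"
  have "card B div 2 \<le> card B" by simp
  then obtain A where A: "A \<subseteq> B" "card A = card B div 2"
    by (meson obtain_subset_with_card_n)
  then have "A \<inter> B = A" by blast
  with A have "splits A B" unfolding splits_def by (auto elim!: oddE)
  with A B show "\<exists>A\<in>Pow {1..k}. splits A B" by blast
qed simp

lemma splitting_family_sizes_finite: "finite (splitting_family_sizes k)"
proof -
  have "splitting_family_sizes k \<subseteq> card ` Pow (Pow {1..k})"
    by (auto simp: splitting_family_sizes_def splitting_family_def)
  then show ?thesis by (rule finite_subset) simp
qed

lemma splitting_family_sizes_nonempty: "splitting_family_sizes k \<noteq> {}"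
  using splitting_family_Pow by (auto simp: splitting_family_sizes_def)

end

theory Submission
  imports Defs
begin

text \<open>Lower bound: to each member \<open>A\<close> of the family attach the linear form
  \<open>L\<^sub>A(B) = 2|A \<inter> B| - |B|\<close> in the indicator variables \<open>[i \<in> B]\<close>. Its parity is that of \<open>|B|\<close>, so it
  never vanishes on odd sets, and it vanishes on an even set exactly when \<open>A\<close> splits that set. Hence
  for a splitting family the product \<open>Q\<close> of these forms is zero on all even sets and nonzero on all
  odd ones, while as a polynomial on the cube it has degree at most \<open>|\<A>|\<close>, that is, its Fourier
  coefficients at sets larger than \<open>|\<A>|\<close> vanish (\<open>fourier_coeff_prod_discrepancy\<close>).
  Vanishing on even sets means that \<open>Q\<close> is its own negative after multiplication by the top
  character \<open>(-1)\<^bsup>|B|\<^esup>\<close>, so that the coefficients at a set and at its complement are opposite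
  (\<open>fourier_coeff_complement\<close>). If \<open>|\<A>| < k/2\<close>, one of the two is always larger than \<open>|\<A>|\<close>; so
  all coefficients of \<open>Q\<close> vanish, and \<open>Q = 0\<close>, which is absurd at a singleton.

  Upper bound: with \<open>m = \<lceil>k/2\<rceil>\<close>, slide a window of length \<open>m\<close> from \<open>{1..m}\<close> to \<open>{m+1..2m}\<close>. The
  number of elements of \<open>B\<close> in the window changes by at most one at each step, and the first and the
  last window together contain all of \<open>B\<close>, so \<open>\<lfloor>|B|/2\<rfloor>\<close> is attained on the way. The last of the
  \<open>m + 1\<close> windows is superfluous: it is the complement of the first one in \<open>{1..2m}\<close>, so both split
  the same sets.\<close>

section \<open>Fourier coefficients on the cube of subsets\<close>

definition fourier_coeff :: "'a set \<Rightarrow> ('a set \<Rightarrow> int) \<Rightarrow> 'a set \<Rightarrow> int" where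
  "fourier_coeff U f S = (\<Sum>B\<in>Pow U. f B * (-1) ^ card (S \<inter> B))"

definition discrepancy :: "'a set \<Rightarrow> 'a set \<Rightarrow> int" where
  "discrepancy A B = 2 * int (card (A \<inter> B)) - int (card B)"

lemma character_sym_diff_singleton:
  fixes S B :: "'a set"
  assumes "finite B"
  shows "(-1 :: int) ^ card (sym_diff S {i} \<inter> B)
           = (if i \<in> B then -1 else 1) * (-1) ^ card (S \<inter> B)"
proof (cases "i \<in> B")
  case False
  then have "sym_diff S {i} \<inter> B = S \<inter> B" by auto
  with False show ?thesis by simp
next
  case True
  have fin: "finite (S \<inter> B)" using assms by simp
  show ?thesis
  proof (cases "i \<in> S")
    case iS: True
    then have "sym_diff S {i} \<inter> B = (S \<inter> B) - {i}" by auto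
    moreover have "card (S \<inter> B) = Suc (card ((S \<inter> B) - {i}))"
      using True iS fin by (intro card_Suc_Diff1[symmetric]) auto
    ultimately show ?thesis using True by simp
  next
    case iS: False
    then have "sym_diff S {i} \<inter> B = insert i (S \<inter> B)" using True by auto
    with True iS fin show ?thesis by simp
  qed
qed

text \<open>The indicator of \<open>i \<in> B\<close> is half the difference of the trivial character and the character of
  \<open>{i}\<close>; multiplying by it therefore only mixes coefficients at sets that differ in \<open>i\<close>.\<close>

lemma fourier_coeff_mult_indicator:
  assumes "finite U"
  shows "2 * fourier_coeff U (\<lambda>B. f B * of_bool (i \<in> B)) S
           = fourier_coeff U f S - fourier_coeff U f (sym_diff S {i})"
proof -
  have "fourier_coeff U f S - fourier_coeff U f (sym_diff S {i})
      = (\<Sum>B\<in>Pow U. f B * ((-1) ^ card (S \<inter> B) - (-1) ^ card (sym_diff S {i} \<inter> B)))"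
    by (simp add: fourier_coeff_def sum_subtractf right_diff_distrib)
  also have "\<dots> = (\<Sum>B\<in>Pow U. 2 * (f B * of_bool (i \<in> B) * (-1) ^ card (S \<inter> B)))"
  proof (rule sum.cong[OF refl])
    fix B assume "B \<in> Pow U"
    then have "finite B" using assms finite_subset by auto
    then show "f B * ((-1) ^ card (S \<inter> B) - (-1) ^ card (sym_diff S {i} \<inter> B))
        = 2 * (f B * of_bool (i \<in> B) * (-1) ^ card (S \<inter> B))"
      by (simp only: character_sym_diff_singleton) simp
  qed
  finally show ?thesis by (simp add: fourier_coeff_def sum_distrib_left)
qed

lemma discrepancy_eq_linear_form:
  assumes "finite U" "B \<subseteq> U"
  shows "discrepancy A B = (\<Sum>i\<in>U. (2 * of_bool (i \<in> A) - 1) * of_bool (i \<in> B))"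
proof -
  have AB: "A \<inter> B = U \<inter> {i. i \<in> A \<and> i \<in> B}" and B: "B = U \<inter> {i. i \<in> B}"
    using assms by auto
  have "(\<Sum>i\<in>U. (2 * of_bool (i \<in> A) - 1) * of_bool (i \<in> B))
      = (\<Sum>i\<in>U. 2 * of_bool (i \<in> A \<and> i \<in> B) - (of_bool (i \<in> B) :: int))"
    by (rule sum.cong) auto
  also have "\<dots> = 2 * int (card (U \<inter> {i. i \<in> A \<and> i \<in> B})) - int (card (U \<inter> {i. i \<in> B}))"
    using assms(1) by (simp add: sum_subtractf sum_distrib_left[symmetric])
  finally show ?thesis unfolding discrepancy_def by (simp only: AB[symmetric] B[symmetric])
qed

text \<open>Hence a discrepancy, being a linear form, raises the degree by at most one.\<close>

lemma fourier_coeff_mult_discrepancy: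
  assumes "finite U" and S: "fourier_coeff U f S = 0"
    and nb: "\<And>i. i \<in> U \<Longrightarrow> fourier_coeff U f (sym_diff S {i}) = 0"
  shows "fourier_coeff U (\<lambda>B. f B * discrepancy A B) S = 0"
proof -
  have "fourier_coeff U (\<lambda>B. f B * discrepancy A B) S
      = (\<Sum>B\<in>Pow U. \<Sum>i\<in>U. (2 * of_bool (i \<in> A) - 1)
            * (f B * of_bool (i \<in> B) * (-1) ^ card (S \<inter> B)))"
    unfolding fourier_coeff_def
    by (rule sum.cong[OF refl])
       (simp add: discrepancy_eq_linear_form[OF assms(1)] sum_distrib_left sum_distrib_right
          mult_ac)
  also have "\<dots> = (\<Sum>i\<in>U. (2 * of_bool (i \<in> A) - 1)
                    * fourier_coeff U (\<lambda>B. f B * of_bool (i \<in> B)) S)"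
    unfolding fourier_coeff_def by (subst sum.swap) (simp add: sum_distrib_left)
  also have "\<dots> = 0"
  proof (rule sum.neutral, rule ballI)
    fix i assume "i \<in> U"
    then have "fourier_coeff U (\<lambda>B. f B * of_bool (i \<in> B)) S = 0"
      using fourier_coeff_mult_indicator[OF assms(1), of f i S] S nb by simp
    then show "(2 * of_bool (i \<in> A) - 1) * fourier_coeff U (\<lambda>B. f B * of_bool (i \<in> B)) S = 0"
      by simp
  qed
  finally show ?thesis .
qed

lemma fourier_coeff_one:
  assumes "finite U" "S \<subseteq> U" "S \<noteq> {}"
  shows "fourier_coeff U (\<lambda>B. 1) S = 0"
proof -
  obtain s where s: "s \<in> S" using assms(3) by auto
  have toggle: "sym_diff (sym_diff B {s}) {s} = B" for B by auto
  have "finite S" using assms finite_subset by blast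
  have toggle_character: "(-1 :: int) ^ card (S \<inter> sym_diff B {s}) = - ((-1) ^ card (S \<inter> B))" for B
    using character_sym_diff_singleton[OF \<open>finite S\<close>, of B s] s
    by (simp only: Int_commute[of S] if_True)
  \<comment> \<open>Toggling \<open>s\<close> in \<open>B\<close> pairs the terms of the sum with their negatives.\<close>
  have "(\<Sum>B\<in>Pow U. (-1 :: int) ^ card (S \<inter> B))
      = (\<Sum>B\<in>Pow U. (-1) ^ card (S \<inter> sym_diff B {s}))"
    by (rule sum.reindex_bij_witness[where i = "\<lambda>B. sym_diff B {s}" and j = "\<lambda>B. sym_diff B {s}"])
       (use s assms(2) in \<open>auto simp only: toggle\<close>)
  also have "\<dots> = (\<Sum>B\<in>Pow U. - ((-1) ^ card (S \<inter> B)))"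
    by (simp only: toggle_character)
  finally show ?thesis by (simp add: fourier_coeff_def sum_negf)
qed

text \<open>A product of \<open>n\<close> discrepancies has degree at most \<open>n\<close>.\<close>

lemma fourier_coeff_prod_discrepancy:
  assumes "finite U" "finite \<A>" "S \<subseteq> U" "card \<A> < card S"
  shows "fourier_coeff U (\<lambda>B. \<Prod>A\<in>\<A>. discrepancy A B) S = 0"
  using assms(2-)
proof (induction \<A> arbitrary: S rule: finite_induct)
  case empty
  then show ?case using fourier_coeff_one[OF assms(1), of S] by (cases "S = {}") simp_all
next
  case (insert A \<A>)
  have "fourier_coeff U (\<lambda>B. \<Prod>A\<in>\<A>. discrepancy A B) (sym_diff S {i}) = 0" if "i \<in> U" for i
  proof (rule insert.IH)
    show "sym_diff S {i} \<subseteq> U" using insert.prems that by auto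
    have "finite S" using insert.prems assms(1) finite_subset by auto
    have "card S - 1 \<le> card (S - {i})" using diff_card_le_card_Diff[of "{i}" S] by simp
    also have "\<dots> \<le> card (sym_diff S {i})" using \<open>finite S\<close> by (intro card_mono) auto
    finally show "card \<A> < card (sym_diff S {i})" using insert by simp
  qed
  moreover have "fourier_coeff U (\<lambda>B. \<Prod>A\<in>\<A>. discrepancy A B) S = 0"
    using insert by (intro insert.IH) auto
  ultimately show ?case
    using fourier_coeff_mult_discrepancy[OF assms(1), of "\<lambda>B. \<Prod>A\<in>\<A>. discrepancy A B" S A] insert
    by (simp add: mult.commute)
qed

text \<open>Without any degree bound, the zero function is preserved: if all coefficients of \<open>f\<close> vanish,
  then so do those of its multiples. The case where \<open>f\<close> is itself the product yields \<open>f = 0\<close> below.\<close>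

lemma fourier_coeff_zero_mult_prod_discrepancy:
  assumes "finite U" "finite \<A>" "\<And>S. S \<subseteq> U \<Longrightarrow> fourier_coeff U f S = 0" "S \<subseteq> U"
  shows "fourier_coeff U (\<lambda>B. f B * (\<Prod>A\<in>\<A>. discrepancy A B)) S = 0"
  using assms(2,4)
proof (induction \<A> arbitrary: S rule: finite_induct)
  case empty
  then show ?case using assms(3) by simp
next
  case (insert A \<A>)
  have "fourier_coeff U (\<lambda>B. f B * (\<Prod>A\<in>\<A>. discrepancy A B)) (sym_diff S {i}) = 0"
    if "i \<in> U" for i
    using insert.prems that by (intro insert.IH) auto
  then show ?case
    using fourier_coeff_mult_discrepancy[OF assms(1) insert.IH, of S A] insert
    by (simp add: mult_ac)
qed

text \<open>The characters of \<open>S\<close> and \<open>U - S\<close> multiply to \<open>(-1)\<^bsup>|B|\<^esup>\<close>, which is \<open>-1\<close> on the support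
  of \<open>f\<close>.\<close>

lemma fourier_coeff_complement:
  assumes "finite U" "S \<subseteq> U" and even0: "\<And>B. B \<subseteq> U \<Longrightarrow> even (card B) \<Longrightarrow> f B = 0"
  shows "fourier_coeff U f (U - S) = - fourier_coeff U f S"
proof -
  have "f B * (-1) ^ card ((U - S) \<inter> B) = - (f B * (-1) ^ card (S \<inter> B))" if "B \<subseteq> U" for B
  proof (cases "even (card B)")
    case True
    then show ?thesis using even0 that by simp
  next
    case False
    have fin: "finite B" using that assms(1) finite_subset by auto
    have "card B = card ((U - S) \<inter> B) + card (S \<inter> B)"
      using fin that assms(2)
      by (subst card_Un_disjoint[symmetric]) (auto intro!: arg_cong[where f = card])
    with False have "even (card ((U - S) \<inter> B)) \<longleftrightarrow> odd (card (S \<inter> B))" by simp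
    then show ?thesis by (cases "even (card (S \<inter> B))") simp_all
  qed
  then show ?thesis unfolding fourier_coeff_def by (simp add: sum_negf[symmetric])
qed

section \<open>The lower bound\<close>

lemma even_discrepancy_iff: "even (discrepancy A B) \<longleftrightarrow> even (card B)"
  by (simp add: discrepancy_def)

lemma card_ge_half_if_discrepancies_vanish:
  assumes U: "finite U" "U \<noteq> {}" and "finite \<A>"
    and van: "\<And>B. B \<subseteq> U \<Longrightarrow> even (card B) \<Longrightarrow> \<exists>A\<in>\<A>. discrepancy A B = 0"
  shows "card U \<le> 2 * card \<A>"
proof (rule ccontr)
  assume less: "\<not> card U \<le> 2 * card \<A>"
  define Q where "Q B = (\<Prod>A\<in>\<A>. discrepancy A B)" for B
  have Q_even: "Q B = 0" if "B \<subseteq> U" "even (card B)" for B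
    using van[OF that] \<open>finite \<A>\<close> by (auto simp: Q_def)
  have coeff: "fourier_coeff U Q S = 0" if S: "S \<subseteq> U" for S
  proof (cases "card \<A> < card S")
    case True
    then show ?thesis
      using fourier_coeff_prod_discrepancy[OF U(1) \<open>finite \<A>\<close> S] by (simp add: Q_def[abs_def])
  next
    case False
    then have "card \<A> < card (U - S)"
      using less S U(1) by (simp add: card_Diff_subset finite_subset)
    then have "fourier_coeff U Q (U - S) = 0"
      using fourier_coeff_prod_discrepancy[OF U(1) \<open>finite \<A>\<close>, of "U - S"]
      by (simp add: Q_def[abs_def])
    then show ?thesis using fourier_coeff_complement[OF U(1) S, of Q] Q_even by simp
  qed
  \<comment> \<open>Instead of Fourier inversion: \<open>Q\<close> times the polynomial \<open>Q\<close> again has no coefficients, and its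
    coefficient at the empty set is the squared norm of \<open>Q\<close>.\<close>
  have "fourier_coeff U (\<lambda>B. Q B * Q B) {} = 0"
    using fourier_coeff_zero_mult_prod_discrepancy[OF U(1) \<open>finite \<A>\<close> coeff, of "{}"]
    by (simp add: Q_def)
  then have "(\<Sum>B\<in>Pow U. Q B * Q B) = 0" by (simp add: fourier_coeff_def)
  then have Q0: "Q B = 0" if "B \<subseteq> U" for B
    using U(1) that by (subst (asm) sum_nonneg_eq_0_iff) auto
  obtain u where u: "u \<in> U" using U(2) by auto
  have "discrepancy A {u} \<noteq> 0" for A
    using even_discrepancy_iff[of A "{u}"] by auto
  then have "Q {u} \<noteq> 0" using \<open>finite \<A>\<close> by (simp add: Q_def)
  with Q0[of "{u}"] u show False by simp
qed

lemma splitting_family_card_ge: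
  assumes "splitting_family k \<A>"
  shows "k \<le> 2 * card \<A>"
proof (cases "k = 0")
  case False
  have "\<exists>A\<in>\<A>. discrepancy A B = 0" if B: "B \<subseteq> {1..k}" "even (card B)" for B
  proof -
    obtain A where A: "A \<in> \<A>" "splits A B"
      using assms B(1) by (auto simp only: splitting_family_def)
    then have "card (A \<inter> B) = card B div 2" using B(2) by (simp add: splits_def)
    moreover have "2 * (card B div 2) = card B" using B(2) by simp
    ultimately have "discrepancy A B = 0" unfolding discrepancy_def by linarith
    with A(1) show ?thesis by blast
  qed
  then show ?thesis
    using card_ge_half_if_discrepancies_vanish[of "{1..k}" \<A>] False
      splitting_family_finite[OF assms] by simp
qed simp

section \<open>The upper bound\<close>

lemma splitsI_floor: "card (A \<inter> B) = card B div 2 \<Longrightarrow> splits A B"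
  by (cases "even (card B)") (simp_all add: splits_def, presburger)

lemma splitsI_ceiling: "card (A \<inter> B) = card B - card B div 2 \<Longrightarrow> splits A B"
  by (cases "even (card B)") (simp_all add: splits_def, presburger+)

lemma card_window_shift:
  fixes B :: "nat set"
  assumes "0 < m"
  shows "\<bar>int (card ({Suc i..<Suc i + m} \<inter> B)) - int (card ({i..<i + m} \<inter> B))\<bar> \<le> 1"
proof -
  define C where "C = {Suc i..<i + m} \<inter> B"
  have "{Suc i..<Suc i + m} \<inter> B = (if i + m \<in> B then insert (i + m) C else C)"
    "{i..<i + m} \<inter> B = (if i \<in> B then insert i C else C)"
    using assms by (auto simp: C_def less_Suc_eq Suc_le_eq order.order_iff_strict)
  moreover have "finite C" "i + m \<notin> C" "i \<notin> C" by (auto simp: C_def)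
  ultimately show ?thesis by simp
qed

text \<open>The two bounds on \<open>m\<close> say \<open>m = \<lceil>k/2\<rceil>\<close>: all \<open>m\<close> windows fit into \<open>{1..k}\<close>, and the windows
  starting at \<open>1\<close> and at \<open>m + 1\<close> cover \<open>{1..k}\<close>. For odd \<open>k\<close> the latter sticks out of \<open>{1..k}\<close>, but it
  only serves the interpolation and is not a member of the family.\<close>

lemma splitting_family_windows:
  assumes "2 * m \<le> Suc k" "k \<le> 2 * m" "0 < m"
  shows "splitting_family k ((\<lambda>i. {i..<i + m}) ` {1..m})"
  unfolding splitting_family_def
proof (intro conjI allI impI)
  show "(\<lambda>i. {i..<i + m}) ` {1..m} \<subseteq> Pow {1..k}" using assms(1) by auto
next
  fix B assume B: "B \<subseteq> {1..k}"
  define g where "g i = int (card ({Suc i..<Suc i + m} \<inter> B))" for i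
  define h where "h = card B div 2"
  have fin: "finite B" using B finite_subset by blast
  have "B \<subseteq> {Suc 0..<Suc 0 + m} \<union> {Suc m..<Suc m + m}"
    using B assms(2) by auto
  then have "B = ({Suc 0..<Suc 0 + m} \<inter> B) \<union> ({Suc m..<Suc m + m} \<inter> B)"
    by blast
  then have "card B = card (({Suc 0..<Suc 0 + m} \<inter> B) \<union> ({Suc m..<Suc m + m} \<inter> B))"
    by (rule arg_cong[where f = card])
  also have "\<dots> = card ({Suc 0..<Suc 0 + m} \<inter> B) + card ({Suc m..<Suc m + m} \<inter> B)"
    using fin by (intro card_Un_disjoint) auto
  finally have ends: "g 0 + g m = int (card B)" by (simp add: g_def)
  have step: "\<bar>g (Suc i) - g i\<bar> \<le> 1" for i
    using card_window_shift[of m "Suc i" B] assms(3) by (simp add: g_def)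
  have "\<exists>i\<le>m. g i = int h"
  proof (cases "g 0 \<le> int h")
    case True
    then have "int h \<le> g m" using ends by (simp add: h_def)
    with True step show ?thesis
      by (intro nat0_intermed_int_val) auto
  next
    case False
    then have "g m \<le> int h" using ends by (simp add: h_def)
    with False step have "\<exists>i\<le>m. - g i = - int h"
      by (intro nat0_intermed_int_val) (auto simp: abs_minus_commute)
    then show ?thesis by simp
  qed
  then obtain i where i: "i \<le> m" "g i = int h" by blast
  have "\<exists>j<m. splits {Suc j..<Suc j + m} B"
  proof (cases "i < m")
    case True
    have "splits {Suc i..<Suc i + m} B"
      using i by (intro splitsI_floor) (simp add: g_def h_def)
    with True show ?thesis by blast
  next
    case False
    \<comment> \<open>If the half is held by the excluded last window, then the first one holds the rest.\<close>
    then have "g 0 = int (card B) - int h" using i ends by simp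
    then have "card ({Suc 0..<Suc 0 + m} \<inter> B) = card B - card B div 2"
      by (simp add: g_def h_def of_nat_diff)
    then have "splits {Suc 0..<Suc 0 + m} B" by (rule splitsI_ceiling)
    with assms(3) show ?thesis by (intro exI[of _ 0] conjI)
  qed
  then obtain j where "j < m" "splits {Suc j..<Suc j + m} B" by blast
  then show "\<exists>A\<in>(\<lambda>i. {i..<i + m}) ` {1..m}. splits A B"
    by (intro bexI[of _ "{Suc j..<Suc j + m}"] image_eqI[of _ _ "Suc j"]) auto
qed

section \<open>The minimum size\<close>

theorem theorem2p1:
  fixes k :: nat
  assumes "k \<ge> 1"
  shows "(\<forall>\<A>. splitting_family k \<A> \<longrightarrow> real (card \<A>) \<ge> real k / 2) \<and>
         int (Min (splitting_family_sizes k)) = \<lceil>real k / 2\<rceil>"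
proof
  show lower: "\<forall>\<A>. splitting_family k \<A> \<longrightarrow> real (card \<A>) \<ge> real k / 2"
    using splitting_family_card_ge by fastforce
  define m where "m = Suc k div 2"
  define W where "W = (\<lambda>i. {i..<i + m}) ` {1..m}"
  have W: "splitting_family k W"
    unfolding W_def using assms by (intro splitting_family_windows) (auto simp: m_def)
  have m_le: "m \<le> card \<A>" if "splitting_family k \<A>" for \<A>
    using splitting_family_card_ge[OF that] by (simp add: m_def)
  have "card W \<le> m" unfolding W_def using card_image_le[of "{1..m}"] by fastforce
  with m_le[OF W] have "m \<in> splitting_family_sizes k"
    using W by (auto simp: splitting_family_sizes_def intro!: exI[of _ W])
  then have "Min (splitting_family_sizes k) = m"
    using m_le splitting_family_sizes_finite
    by (intro Min_eqI) (auto simp: splitting_family_sizes_def)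
  moreover have "\<lceil>real k / 2\<rceil> = int m"
    unfolding m_def by (cases "even k") (auto elim!: evenE oddE intro!: ceiling_unique)
  ultimately show "int (Min (splitting_family_sizes k)) = \<lceil>real k / 2\<rceil>" by simp
qed

end
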